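(* Let $\Gamma$ be a non-empty set and let $\|\cdot\|$ be an equivalent norm on $c_0(\Gamma)$ such that the canonical basis $(e_\gamma)_{\gamma\in\Gamma}$ is normalized and 1-symmetric. If $\|\cdot\|$ is strictly monotone, in particular if $\|\cdot\|$ is strictly convex, then $(c_0(\Gamma),\|\cdot\|)$ fails the local diameter two property.
   Context: All spaces are real. $c_0(\Gamma)$ carries its canonical basis $(e_\gamma)_{\gamma\in\Gamma}$ of unit vectors; normalized means $\|e_\gamma\|=1$ for all $\gamma$. The canonical basis is 1-symmetric if $\|\cdot\|$ is a lattice norm (i.e. $\|y\|\le\|x\|$ whenever $x,y \in c_0(\Gamma)$ and $|y(\gamma)|\le|x(\gamma)|$ for all $\gamma\in\Gamma$) and for every $x\in c_0(\Gamma)$ and every permutation $\pi:\Gamma\to\Gamma$ the function $x_\pi(\gamma)=x(\pi(\gamma))$ satisfies $\|x_\pi\|=\|x\|$. The norm is strictly monotone if $\|y\|<\|x\|$ whenever $|y(\gamma)|\le|x(\gamma)|$ for all $\gamma\in\Gamma$ and $|y(\beta)|<|x(\beta)|$ for some $\beta\in\Gamma$. The norm is strictly convex if $\frac12\|x+y\|=\|x\|=\|y\|$ implies $x=y$. A slice of the closed unit ball $B_X$ of a Banach space $X$ is a set $S(x^*,\varepsilon)=\{x\in B_X:x^*(x)>1-\varepsilon\}$ with $x^*\in X^*$, $\|x^*\|=1$, $\varepsilon>0$. $X$ has the local diameter two property (LD2P) if every slice of $B_X$ has diameter two. *)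

theory Defs
  imports "HOL-Analysis.Analysis"
begin

section \<open>The space $c_0(\Gamma)$\<close>

text \<open>
  The non-empty index set is the universe of the type variable \<open>'g\<close>.
\<close>

typedef 'g c0 = "{x :: 'g \<Rightarrow> real. \<forall>\<epsilon>>0. finite {\<gamma>. \<bar>x \<gamma>\<bar> \<ge> \<epsilon>}}"
  morphisms c0_apply Abs_c0
  by (rule exI[of _ "\<lambda>_. 0"]) auto

setup_lifting type_definition_c0

lemma c0_eqI: "(\<And>\<gamma>. c0_apply x \<gamma> = c0_apply y \<gamma>) \<Longrightarrow> x = y"
  by (metis c0_apply_inject ext)

lemma c0_finite: "\<epsilon> > 0 \<Longrightarrow> finite {\<gamma>. \<bar>c0_apply x \<gamma>\<bar> \<ge> \<epsilon>}"
  using c0_apply[of x] by auto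

instantiation c0 :: (type) real_vector
begin

lift_definition zero_c0 :: "'a c0" is "\<lambda>_. 0"
  by auto

lift_definition uminus_c0 :: "'a c0 \<Rightarrow> 'a c0" is "\<lambda>x \<gamma>. - x \<gamma>"
  by auto

lift_definition plus_c0 :: "'a c0 \<Rightarrow> 'a c0 \<Rightarrow> 'a c0" is "\<lambda>x y \<gamma>. x \<gamma> + y \<gamma>"
proof -
  fix x y :: "'a \<Rightarrow> real" and \<epsilon> :: real
  assume x: "\<And>\<epsilon>. \<epsilon> > 0 \<Longrightarrow> finite {\<gamma>. \<bar>x \<gamma>\<bar> \<ge> \<epsilon>}"
    and y: "\<And>\<epsilon>. \<epsilon> > 0 \<Longrightarrow> finite {\<gamma>. \<bar>y \<gamma>\<bar> \<ge> \<epsilon>}" and "\<epsilon> > 0"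
  then have "finite ({\<gamma>. \<bar>x \<gamma>\<bar> \<ge> \<epsilon> / 2} \<union> {\<gamma>. \<bar>y \<gamma>\<bar> \<ge> \<epsilon> / 2})"
    by (simp del: le_divide_eq_numeral1 divide_le_eq_numeral1)
  then show "finite {\<gamma>. \<bar>x \<gamma> + y \<gamma>\<bar> \<ge> \<epsilon>}"
    by (rule rev_finite_subset) auto
qed

lift_definition scaleR_c0 :: "real \<Rightarrow> 'a c0 \<Rightarrow> 'a c0" is "\<lambda>c x \<gamma>. c * x \<gamma>"
proof -
  fix c :: real and x :: "'a \<Rightarrow> real" and \<epsilon> :: real
  assume x: "\<And>\<epsilon>. \<epsilon> > 0 \<Longrightarrow> finite {\<gamma>. \<bar>x \<gamma>\<bar> \<ge> \<epsilon>}" and e: "\<epsilon> > 0"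
  show "finite {\<gamma>. \<bar>c * x \<gamma>\<bar> \<ge> \<epsilon>}"
  proof (cases "c = 0")
    case False
    then have "{\<gamma>. \<bar>c * x \<gamma>\<bar> \<ge> \<epsilon>} = {\<gamma>. \<bar>x \<gamma>\<bar> \<ge> \<epsilon> / \<bar>c\<bar>}"
      by (auto simp: abs_mult field_simps)
    with False e x show ?thesis by auto
  qed (use e in auto)
qed

definition minus_c0 :: "'a c0 \<Rightarrow> 'a c0 \<Rightarrow> 'a c0"
  where "minus_c0 x y = x + - y"

instance
  by standard
    (auto intro!: c0_eqI simp: minus_c0_def zero_c0.rep_eq uminus_c0.rep_eq plus_c0.rep_eq
      scaleR_c0.rep_eq distrib_left distrib_right)

end

lemma c0_apply_simps [simp]:
  "c0_apply 0 \<gamma> = 0"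
  "c0_apply (- x) \<gamma> = - c0_apply x \<gamma>"
  "c0_apply (x + y) \<gamma> = c0_apply x \<gamma> + c0_apply y \<gamma>"
  "c0_apply (x - y) \<gamma> = c0_apply x \<gamma> - c0_apply y \<gamma>"
  "c0_apply (c *\<^sub>R x) \<gamma> = c * c0_apply x \<gamma>"
  by (simp_all only: minus_c0_def zero_c0.rep_eq uminus_c0.rep_eq plus_c0.rep_eq scaleR_c0.rep_eq diff_conv_add_uminus)

lemma c0_bdd_above: "bdd_above (range (\<lambda>\<gamma>. \<bar>c0_apply x \<gamma>\<bar>))"
proof -
  let ?F = "{\<gamma>. \<bar>c0_apply x \<gamma>\<bar> \<ge> 1}"
  have "finite ?F" by (rule c0_finite) simp
  then have "bdd_above ((\<lambda>\<gamma>. \<bar>c0_apply x \<gamma>\<bar>) ` ?F)"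
    by simp
  moreover have "bdd_above ((\<lambda>\<gamma>. \<bar>c0_apply x \<gamma>\<bar>) ` (- ?F))"
    by (rule bdd_aboveI[of _ 1]) auto
  ultimately have "bdd_above ((\<lambda>\<gamma>. \<bar>c0_apply x \<gamma>\<bar>) ` (?F \<union> - ?F))"
    by (simp only: image_Un bdd_above_Un)
  then show ?thesis
    by (simp only: Compl_partition)
qed

instantiation c0 :: (type) real_normed_vector
begin

definition norm_c0 :: "'a c0 \<Rightarrow> real"
  where "norm_c0 x = (SUP \<gamma>. \<bar>c0_apply x \<gamma>\<bar>)"

definition dist_c0 :: "'a c0 \<Rightarrow> 'a c0 \<Rightarrow> real"
  where "dist_c0 x y = norm (x - y)"

definition sgn_c0 :: "'a c0 \<Rightarrow> 'a c0"
  where "sgn_c0 x = x /\<^sub>R norm x"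

definition uniformity_c0 :: "('a c0 \<times> 'a c0) filter"
  where "uniformity_c0 = (INF e\<in>{0<..}. principal {(x, y). dist x y < e})"

definition open_c0 :: "'a c0 set \<Rightarrow> bool"
  where "open_c0 U = (\<forall>x\<in>U. \<forall>\<^sub>F (x', y) in uniformity. x' = x \<longrightarrow> y \<in> U)"

instance
proof
  have ub: "\<bar>c0_apply x \<gamma>\<bar> \<le> norm x" for x :: "'a c0" and \<gamma>
    unfolding norm_c0_def by (rule cSUP_upper[OF UNIV_I c0_bdd_above])
  have lub: "norm x \<le> B" if "\<And>\<gamma>. \<bar>c0_apply x \<gamma>\<bar> \<le> B" for x :: "'a c0" and B
    unfolding norm_c0_def by (rule cSUP_least) (auto intro: that)
  fix x y :: "'a c0" and c :: real
  show "norm x = 0 \<longleftrightarrow> x = 0"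
  proof
    assume "norm x = 0"
    with ub[of x] show "x = 0" by (intro c0_eqI) auto
  qed (simp add: norm_c0_def)
  show "norm (x + y) \<le> norm x + norm y"
  proof (rule lub)
    fix \<gamma> show "\<bar>c0_apply (x + y) \<gamma>\<bar> \<le> norm x + norm y"
      using ub[of x \<gamma>] ub[of y \<gamma>] by simp
  qed
  have le: "norm (a *\<^sub>R z) \<le> \<bar>a\<bar> * norm z" for a and z :: "'a c0"
    by (rule lub) (simp add: abs_mult mult_left_mono ub)
  show "norm (c *\<^sub>R x) = \<bar>c\<bar> * norm x"
  proof (cases "c = 0")
    case False
    have "\<bar>c\<bar> * norm x = \<bar>c\<bar> * norm (inverse c *\<^sub>R (c *\<^sub>R x))"
      using False by simp
    also have "\<dots> \<le> \<bar>c\<bar> * (\<bar>inverse c\<bar> * norm (c *\<^sub>R x))"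
      by (intro mult_left_mono le) simp
    also have "\<dots> = norm (c *\<^sub>R x)"
      using False by (simp add: field_simps)
    finally show ?thesis using le[of c x] by simp
  qed (simp add: norm_c0_def)
qed (simp_all add: dist_c0_def sgn_c0_def uniformity_c0_def open_c0_def)

end

lift_definition c0_unit :: "'g \<Rightarrow> 'g c0" is "\<lambda>\<gamma> \<beta>. if \<beta> = \<gamma> then 1 else 0"
proof -
  fix \<gamma> :: 'g and \<epsilon> :: real
  assume "\<epsilon> > 0"
  then have "{\<beta>. \<bar>if \<beta> = \<gamma> then 1 else 0 :: real\<bar> \<ge> \<epsilon>} \<subseteq> {\<gamma>}"
    by auto
  then show "finite {\<beta>. \<bar>if \<beta> = \<gamma> then 1 else 0 :: real\<bar> \<ge> \<epsilon>}"
    by (rule finite_subset) simp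
qed

definition c0_permute :: "('g \<Rightarrow> 'g) \<Rightarrow> 'g c0 \<Rightarrow> 'g c0"
  where "c0_permute \<pi> x = Abs_c0 (\<lambda>\<gamma>. c0_apply x (\<pi> \<gamma>))"

lemma c0_apply_permute:
  assumes "bij \<pi>"
  shows "c0_apply (c0_permute \<pi> x) \<gamma> = c0_apply x (\<pi> \<gamma>)"
proof -
  have "finite {\<gamma>. \<bar>c0_apply x (\<pi> \<gamma>)\<bar> \<ge> \<epsilon>}" if "\<epsilon> > 0" for \<epsilon>
    using finite_vimageI[OF c0_finite[OF that, of x] bij_is_inj[OF assms]]
    by (simp add: vimage_def)
  then show ?thesis
    unfolding c0_permute_def by (subst Abs_c0_inverse) auto
qed

section \<open>Norms other than the one of the type class\<close>

text \<open>
  The renormings below are functions \<open>N\<close> on a type whose own \<^term>\<open>norm\<close> (for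
  \<open>'g c0\<close>, the supremum norm) is the original one.  Hence dual space, unit ball,
  slices and diameters are all taken with respect to \<open>N\<close> explicitly.
\<close>

definition is_norm :: "('v::real_vector \<Rightarrow> real) \<Rightarrow> bool"
  where "is_norm N \<longleftrightarrow>
    (\<forall>x. N x = 0 \<longleftrightarrow> x = 0) \<and>
    (\<forall>c x. N (c *\<^sub>R x) = \<bar>c\<bar> * N x) \<and>
    (\<forall>x y. N (x + y) \<le> N x + N y)"

definition equivalent_norm :: "('v::real_normed_vector \<Rightarrow> real) \<Rightarrow> bool"
  where "equivalent_norm N \<longleftrightarrow> is_norm N \<and>
    (\<exists>a>0. \<exists>b>0. \<forall>x. a * norm x \<le> N x \<and> N x \<le> b * norm x)"

definition strictly_convex_norm :: "('v::real_vector \<Rightarrow> real) \<Rightarrow> bool"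
  where "strictly_convex_norm N \<longleftrightarrow>
    (\<forall>x y. 1/2 * N (x + y) = N x \<and> N x = N y \<longrightarrow> x = y)"

definition unit_ball :: "('v::real_vector \<Rightarrow> real) \<Rightarrow> 'v set"
  where "unit_ball N = {x. N x \<le> 1}"

definition dual_space :: "('v::real_vector \<Rightarrow> real) \<Rightarrow> ('v \<Rightarrow> real) set"
  where "dual_space N = {f. linear f \<and> (\<exists>K. \<forall>x. \<bar>f x\<bar> \<le> K * N x)}"

definition dual_norm :: "('v::real_vector \<Rightarrow> real) \<Rightarrow> ('v \<Rightarrow> real) \<Rightarrow> real"
  where "dual_norm N f = (SUP x\<in>unit_ball N. \<bar>f x\<bar>)"

definition slice :: "('v::real_vector \<Rightarrow> real) \<Rightarrow> ('v \<Rightarrow> real) \<Rightarrow> real \<Rightarrow> 'v set"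
  where "slice N f \<epsilon> = {x \<in> unit_ball N. f x > 1 - \<epsilon>}"

definition diameter_wrt :: "('v::real_vector \<Rightarrow> real) \<Rightarrow> 'v set \<Rightarrow> real"
  where "diameter_wrt N S = (SUP (x, y)\<in>S \<times> S. N (x - y))"

definition LD2P :: "('v::real_vector \<Rightarrow> real) \<Rightarrow> bool"
  where "LD2P N \<longleftrightarrow>
    (\<forall>f\<in>dual_space N. \<forall>\<epsilon>>0. dual_norm N f = 1 \<longrightarrow> diameter_wrt N (slice N f \<epsilon>) = 2)"

section \<open>Norms on $c_0(\Gamma)$ and its canonical basis\<close>

definition normalized_basis :: "('g c0 \<Rightarrow> real) \<Rightarrow> bool"
  where "normalized_basis N \<longleftrightarrow> (\<forall>\<gamma>. N (c0_unit \<gamma>) = 1)"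

definition lattice_norm :: "('g c0 \<Rightarrow> real) \<Rightarrow> bool"
  where "lattice_norm N \<longleftrightarrow>
    (\<forall>x y. (\<forall>\<gamma>. \<bar>c0_apply y \<gamma>\<bar> \<le> \<bar>c0_apply x \<gamma>\<bar>) \<longrightarrow> N y \<le> N x)"

definition one_symmetric_basis :: "('g c0 \<Rightarrow> real) \<Rightarrow> bool"
  where "one_symmetric_basis N \<longleftrightarrow>
    lattice_norm N \<and> (\<forall>x \<pi>. bij \<pi> \<longrightarrow> N (c0_permute \<pi> x) = N x)"

definition strictly_monotone_norm :: "('g c0 \<Rightarrow> real) \<Rightarrow> bool"
  where "strictly_monotone_norm N \<longleftrightarrow>
    (\<forall>x y. (\<forall>\<gamma>. \<bar>c0_apply y \<gamma>\<bar> \<le> \<bar>c0_apply x \<gamma>\<bar>) \<and>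
           (\<exists>\<beta>. \<bar>c0_apply y \<beta>\<bar> < \<bar>c0_apply x \<beta>\<bar>) \<longrightarrow> N y < N x)"

end

theory Submission
  imports Defs
begin

text \<open>
  A strictly monotone norm \<open>N\<close> fails the local diameter two property because every unit vector
  \<open>e\<^sub>\<gamma>\<close> is strongly exposed by its own coordinate functional.  By the lattice property this
  functional has dual norm one.  A point \<open>x\<close> of the slice that it determines has \<open>x \<gamma>\<close> close to
  one, so that a coordinate \<open>x \<beta>\<close> of modulus at least \<open>t\<close> with \<open>\<beta> \<noteq> \<gamma>\<close> would force
  \<open>N x\<close> to be almost as large as \<open>N (e\<^sub>\<gamma> + t e\<^sub>\<beta>)\<close>.  Strict monotonicity makes the latter
  greater than one, and symmetry makes it independent of \<open>\<beta>\<close>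
  (\<open>uniform_norm_gap\<close>).  Hence in a thin slice all the other coordinates are below \<open>t\<close>
  in modulus: the slice is small in the supremum norm, and by equivalence it is small for \<open>N\<close>
  (\<open>coordinate_slice_small\<close>).

  This last step is special to \<open>c\<^sub>0\<close>: smallness of each single coordinate controls the norm of the
  vector, no matter how many coordinates there are.
\<close>

lemma c0_apply_unit: "c0_apply (c0_unit \<gamma>) \<beta> = (if \<beta> = \<gamma> then 1 else 0)"
  by (simp add: c0_unit.rep_eq)

lemma norm_c0_le:
  assumes "\<And>\<gamma>. \<bar>c0_apply x \<gamma>\<bar> \<le> B"
  shows "norm x \<le> B"
  unfolding norm_c0_def by (rule cSUP_least) (auto intro: assms)

lemma lattice_normD:
  assumes "lattice_norm N" "\<And>\<gamma>. \<bar>c0_apply y \<gamma>\<bar> \<le> \<bar>c0_apply x \<gamma>\<bar>"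
  shows "N y \<le> N x"
  using assms unfolding lattice_norm_def by blast

lift_definition c0_abs :: "'g c0 \<Rightarrow> 'g c0" is "\<lambda>x \<gamma>. \<bar>x \<gamma>\<bar>"
  by simp

text \<open>
  If \<open>\<bar>y\<bar> \<le> \<bar>x\<bar>\<close> but \<open>N x \<le> N y\<close>, then the midpoint of \<open>\<bar>x\<bar>\<close> and \<open>\<bar>y\<bar>\<close> lies between them,
  so all three have the same norm and strict convexity forces \<open>\<bar>x\<bar> = \<bar>y\<bar>\<close>.
\<close>

lemma strictly_convex_lattice_imp_strictly_monotone:
  assumes "is_norm N" "lattice_norm N" "strictly_convex_norm N"
  shows "strictly_monotone_norm N"
  unfolding strictly_monotone_norm_def
proof (intro allI impI, elim conjE exE)
  fix x y :: "'a c0" and \<beta>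
  assume le: "\<forall>\<gamma>. \<bar>c0_apply y \<gamma>\<bar> \<le> \<bar>c0_apply x \<gamma>\<bar>"
    and less: "\<bar>c0_apply y \<beta>\<bar> < \<bar>c0_apply x \<beta>\<bar>"
  show "N y < N x"
  proof (rule ccontr)
    assume neg: "\<not> N y < N x"
    have abs_eq: "N (c0_abs z) = N z" for z
      by (intro antisym lattice_normD[OF assms(2)]) (simp_all add: c0_abs.rep_eq)
    have eq: "N (c0_abs x) = N (c0_abs y)"
      using lattice_normD[OF assms(2), of y x] le neg by (simp add: abs_eq)
    have half: "N ((1/2) *\<^sub>R (c0_abs x + c0_abs y)) = 1/2 * N (c0_abs x + c0_abs y)"
      using assms(1) unfolding is_norm_def by simp
    have mono: "\<bar>c0_apply (c0_abs y) \<gamma>\<bar> \<le> \<bar>c0_apply ((1/2) *\<^sub>R (c0_abs x + c0_abs y)) \<gamma>\<bar>" for \<gamma>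
      using le[rule_format, of \<gamma>] by (simp add: c0_abs.rep_eq)
    have "N (c0_abs x + c0_abs y) \<le> N (c0_abs x) + N (c0_abs y)"
      using assms(1) unfolding is_norm_def by blast
    then have "1/2 * N (c0_abs x + c0_abs y) = N (c0_abs x)"
      using lattice_normD[OF assms(2) mono] half eq by simp
    then have "c0_abs x = c0_abs y"
      using eq assms(3) unfolding strictly_convex_norm_def by blast
    then have "c0_apply (c0_abs x) \<beta> = c0_apply (c0_abs y) \<beta>" by simp
    with less show False by (simp add: c0_abs.rep_eq)
  qed
qed

lemma coordinate_le_norm:
  assumes "is_norm N" "lattice_norm N" "normalized_basis N"
  shows "\<bar>c0_apply x \<gamma>\<bar> \<le> N x"
proof -
  have "\<bar>c0_apply x \<gamma>\<bar> = N (c0_apply x \<gamma> *\<^sub>R c0_unit \<gamma>)"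
    using assms(1,3) unfolding is_norm_def normalized_basis_def by simp
  also have "\<dots> \<le> N x"
    by (rule lattice_normD[OF assms(2)]) (simp add: c0_apply_unit)
  finally show ?thesis .
qed

lemma coordinate_in_dual_space:
  assumes "is_norm N" "lattice_norm N" "normalized_basis N"
  shows "(\<lambda>x. c0_apply x \<gamma>) \<in> dual_space N"
  unfolding dual_space_def
  using coordinate_le_norm[OF assms] by (auto intro!: linearI exI[of _ 1])

lemma dual_norm_coordinate:
  assumes "is_norm N" "lattice_norm N" "normalized_basis N"
  shows "dual_norm N (\<lambda>x. c0_apply x \<gamma>) = 1"
  unfolding dual_norm_def
proof (rule cSup_eq_maximum)
  show "1 \<in> (\<lambda>x. \<bar>c0_apply x \<gamma>\<bar>) ` unit_ball N"
    using assms(3)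
    by (intro image_eqI[of _ _ "c0_unit \<gamma>"])
      (auto simp: c0_apply_unit unit_ball_def normalized_basis_def)
  show "z \<le> 1" if "z \<in> (\<lambda>x. \<bar>c0_apply x \<gamma>\<bar>) ` unit_ball N" for z
    using that coordinate_le_norm[OF assms] by (force simp: unit_ball_def intro: order_trans)
qed

text \<open>
  Strict monotonicity alone gives a gap for each \<open>\<beta>\<close>, and for infinite \<open>\<Gamma>\<close> these gaps could
  shrink to zero.  Transposing two indices different from \<open>\<gamma>\<close> shows that they are all equal.
\<close>

lemma uniform_norm_gap:
  assumes "normalized_basis N" "one_symmetric_basis N" "strictly_monotone_norm N" "t > 0"
  shows "\<exists>c>1. \<forall>\<beta>. \<beta> \<noteq> \<gamma> \<longrightarrow> c \<le> N (c0_unit \<gamma> + t *\<^sub>R c0_unit \<beta>)"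
proof (cases "\<exists>\<beta>. \<beta> \<noteq> \<gamma>")
  case True
  then obtain \<alpha> where \<alpha>: "\<alpha> \<noteq> \<gamma>" by blast
  have "N (c0_unit \<gamma>) < N (c0_unit \<gamma> + t *\<^sub>R c0_unit \<alpha>)"
    using assms(3) \<alpha> assms(4) unfolding strictly_monotone_norm_def
    by (elim allE[of _ "c0_unit \<gamma> + t *\<^sub>R c0_unit \<alpha>"] allE[of _ "c0_unit \<gamma>"] impE)
      (auto simp: c0_apply_unit intro!: exI[of _ \<alpha>])
  then have "1 < N (c0_unit \<gamma> + t *\<^sub>R c0_unit \<alpha>)"
    using assms(1) by (simp add: normalized_basis_def)
  moreover have "N (c0_unit \<gamma> + t *\<^sub>R c0_unit \<alpha>) = N (c0_unit \<gamma> + t *\<^sub>R c0_unit \<beta>)"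
    if "\<beta> \<noteq> \<gamma>" for \<beta>
  proof -
    let ?\<pi> = "Transposition.transpose \<alpha> \<beta>"
    have "c0_permute ?\<pi> (c0_unit \<gamma> + t *\<^sub>R c0_unit \<alpha>) = c0_unit \<gamma> + t *\<^sub>R c0_unit \<beta>"
      using \<alpha> that
      by (intro c0_eqI)
        (auto simp: c0_apply_permute c0_apply_unit Transposition.transpose_def)
    then show ?thesis
      using assms(2) unfolding one_symmetric_basis_def by (metis bij_transpose)
  qed
  ultimately show ?thesis by (metis order_refl)
next
  case False
  then show ?thesis by (auto intro!: exI[of _ 2])
qed

text \<open>
  The coordinates other than \<open>\<gamma>\<close> are kept below \<open>t = r / (2 b)\<close>, where \<open>b\<close> is the constant with
  \<open>N \<le> b \<parallel>\<cdot>\<parallel>\<^sub>\<infinity>\<close>: two points of the slice then differ by at most \<open>r / b\<close> in each coordinate.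
\<close>

lemma coordinate_slice_small:
  assumes "equivalent_norm N" "normalized_basis N" "one_symmetric_basis N"
    and "strictly_monotone_norm N" "r > 0"
  shows "\<exists>\<epsilon>>0. \<forall>x\<in>slice N (\<lambda>x. c0_apply x \<gamma>) \<epsilon>. \<forall>y\<in>slice N (\<lambda>x. c0_apply x \<gamma>) \<epsilon>. N (x - y) \<le> r"
proof -
  have N: "is_norm N" using assms(1) by (simp add: equivalent_norm_def)
  have lat: "lattice_norm N" using assms(3) by (simp add: one_symmetric_basis_def)
  obtain b where b: "b > 0" "\<And>x. N x \<le> b * norm x"
    using assms(1) unfolding equivalent_norm_def by blast
  define t where "t = r / (2 * b)"
  have t: "t > 0" using b(1) assms(5) by (simp add: t_def)
  obtain c where c: "c > 1" "\<And>\<beta>. \<beta> \<noteq> \<gamma> \<Longrightarrow> c \<le> N (c0_unit \<gamma> + t *\<^sub>R c0_unit \<beta>)"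
    using uniform_norm_gap[OF assms(2-4) t] by blast
  define \<epsilon> where "\<epsilon> = min (2 * t) (min 1 (c - 1)) / 2"
  have \<epsilon>: "0 < \<epsilon>" "\<epsilon> < 1" "\<epsilon> < c - 1" "\<epsilon> < 2 * t"
    using t c(1) by (auto simp: \<epsilon>_def min_def)
  let ?S = "slice N (\<lambda>x. c0_apply x \<gamma>) \<epsilon>"
  have near_one: "1 - \<epsilon> < c0_apply x \<gamma>" "c0_apply x \<gamma> \<le> 1" if "x \<in> ?S" for x
    using that coordinate_le_norm[OF N lat assms(2), of x \<gamma>]
    by (auto simp: slice_def unit_ball_def)
  have small: "\<bar>c0_apply x \<beta>\<bar> < t" if x: "x \<in> ?S" and \<beta>: "\<beta> \<noteq> \<gamma>" for x \<beta>
  proof (rule ccontr)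
    assume "\<not> \<bar>c0_apply x \<beta>\<bar> < t"
    then have "N ((1 - \<epsilon>) *\<^sub>R c0_unit \<gamma> + t *\<^sub>R c0_unit \<beta>) \<le> N x"
      using near_one(1)[OF x] \<beta> \<epsilon>(2) t
      by (intro lattice_normD[OF lat]) (auto simp: c0_apply_unit)
    also have "N x \<le> 1" using x by (simp add: slice_def unit_ball_def)
    finally have "N ((1 - \<epsilon>) *\<^sub>R c0_unit \<gamma> + t *\<^sub>R c0_unit \<beta>) \<le> 1" .
    moreover have "N (\<epsilon> *\<^sub>R c0_unit \<gamma>) = \<epsilon>"
      using N assms(2) \<epsilon>(1) by (simp add: is_norm_def normalized_basis_def)
    moreover have "c0_unit \<gamma> + t *\<^sub>R c0_unit \<beta>
        = ((1 - \<epsilon>) *\<^sub>R c0_unit \<gamma> + t *\<^sub>R c0_unit \<beta>) + \<epsilon> *\<^sub>R c0_unit \<gamma>"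
      by (simp add: algebra_simps)
    then have "N (c0_unit \<gamma> + t *\<^sub>R c0_unit \<beta>)
        \<le> N ((1 - \<epsilon>) *\<^sub>R c0_unit \<gamma> + t *\<^sub>R c0_unit \<beta>) + N (\<epsilon> *\<^sub>R c0_unit \<gamma>)"
      using N unfolding is_norm_def by metis
    ultimately show False using c(2)[OF \<beta>] \<epsilon>(3) by linarith
  qed
  have "N (x - y) \<le> r" if "x \<in> ?S" "y \<in> ?S" for x y
  proof -
    have "\<bar>c0_apply (x - y) \<beta>\<bar> \<le> 2 * t" for \<beta>
    proof (cases "\<beta> = \<gamma>")
      case True
      with near_one[OF that(1)] near_one[OF that(2)] \<epsilon>(4) show ?thesis by simp
    next
      case False
      with small[OF that(1) False] small[OF that(2) False] show ?thesis by simp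
    qed
    then have "b * norm (x - y) \<le> b * (2 * t)"
      using b(1) by (intro mult_left_mono norm_c0_le) auto
    also have "b * (2 * t) = r" using b(1) by (simp add: t_def)
    finally show ?thesis using b(2)[of "x - y"] by linarith
  qed
  with \<epsilon>(1) show ?thesis by blast
qed

lemma strictly_monotone_imp_not_LD2P:
  fixes N :: "'g c0 \<Rightarrow> real"
  assumes "equivalent_norm N" "normalized_basis N" "one_symmetric_basis N"
    and "strictly_monotone_norm N"
  shows "\<not> LD2P N"
proof
  assume "LD2P N"
  fix \<gamma> :: 'g
  let ?f = "\<lambda>x. c0_apply x \<gamma>"
  have N: "is_norm N" and lat: "lattice_norm N"
    using assms(1,3) by (simp_all add: equivalent_norm_def one_symmetric_basis_def)
  obtain \<epsilon> where \<epsilon>: "\<epsilon> > 0"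
      "\<And>x y. x \<in> slice N ?f \<epsilon> \<Longrightarrow> y \<in> slice N ?f \<epsilon> \<Longrightarrow> N (x - y) \<le> 1"
    using coordinate_slice_small[OF assms, of 1 \<gamma>] by (metis zero_less_one)
  (* The supremum defining the diameter is taken over a non-empty set only because e_gamma
     belongs to the slice. *)
  have "c0_unit \<gamma> \<in> slice N ?f \<epsilon>"
    using assms(2) \<epsilon>(1)
    by (simp add: slice_def unit_ball_def normalized_basis_def c0_apply_unit)
  then have "diameter_wrt N (slice N ?f \<epsilon>) \<le> 1"
    unfolding diameter_wrt_def by (intro cSUP_least) (auto intro: \<epsilon>(2))
  moreover have "diameter_wrt N (slice N ?f \<epsilon>) = 2"
    using \<open>LD2P N\<close> \<epsilon>(1) coordinate_in_dual_space[OF N lat assms(2)]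
      dual_norm_coordinate[OF N lat assms(2)]
    unfolding LD2P_def by blast
  ultimately show False by simp
qed

theorem theorem4p4:
  fixes N :: "'g c0 \<Rightarrow> real"
  assumes "equivalent_norm N"
    and "normalized_basis N"
    and "one_symmetric_basis N"
  shows "(strictly_monotone_norm N \<longrightarrow> \<not> LD2P N) \<and>
         (strictly_convex_norm N \<longrightarrow> strictly_monotone_norm N \<and> \<not> LD2P N)"
proof -
  have "strictly_monotone_norm N" if "strictly_convex_norm N"
    using strictly_convex_lattice_imp_strictly_monotone that assms(1,3)
    by (auto simp: equivalent_norm_def one_symmetric_basis_def)
  then show ?thesis
    using strictly_monotone_imp_not_LD2P[OF assms] by blast
qed

end
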